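(* Assume that there exist constants $C>0$ and $s>0$ such that for all balls $B(y,R)$ in $X$, all $z\in B(y,R)$ and all $0<r\le R$, $$\frac{\mu(B(z,r))}{\mu(B(y,R))}\le C\Big(\frac rR\Big)^s.$$ Let $1<p<\infty$, $1<\tilde p<\infty$, $0<\gamma<1$ and $0<\tilde\gamma<1$ be such that $\gamma p<1$, $\tilde\gamma\tilde p<1$ and $\tilde\gamma\tilde p<\gamma p$. Let $E\subset X$. If $\mathcal{C}_{\gamma,p}(E)=0$, then $\widetilde{\mathcal{H}}^{\tilde\gamma,\tilde p}_\infty(E)=0$.
   Context: Setting: $X=(X,d,\mu)$ is a locally compact metric space equipped with a Borel regular outer measure $\mu$ that is doubling, i.e. there is a constant $c_d\ge 1$ with $\mu(B(x,2r))\le c_d\,\mu(B(x,r))$ for every ball $B(x,r)=\{y\in X: d(y,x)<r\}$. Every open ball has positive and finite measure. Spheres have measure zero, $\mu(\{y\in X: d(x,y)=r\})=0$ for all $x\in X$, $r>0$, and points have measure zero, $\mu(\{x\})=0$ for all $x\in X$. For $0<\gamma<1$, the Riesz potential of order $\gamma$ of a measurable function $f$ is $$I_\gamma f(x)=\int_X \frac{f(y)}{\mu(B(x,d(x,y)))^{1-\gamma}}\,d\mu(y)$$ (the single point $y=x$ may be omitted from the domain of integration, since it is $\mu$-null). $L^p_+(X)$ denotes the set of non-negative functions in $L^p(X)=L^p(X,\mu)$. For $1<p<\infty$ and any $E\subset X$, the Riesz $(\gamma,p)$-capacity is $\mathcal{C}_{\gamma,p}(E)=\inf_{f\in\mathcal{A}(E)}\|f\|_{L^p(X)}^p$,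 where $\mathcal{A}(E)=\{f\in L^p_+(X): I_\gamma f\ge 1\text{ on }E\}$ and $\mathcal{C}_{\gamma,p}(E)=\infty$ if $\mathcal{A}(E)=\emptyset$. For $1<p<\infty$, $0<\gamma<1$ with $\gamma p<1$ and $0<r\le\infty$, the (modified) Hausdorff content of $E\subset X$ is $$\widetilde{\mathcal{H}}^{\gamma,p}_r(E)=\inf\Big\{\sum_{i=1}^\infty\mu(B(x_i,r_i))^{1-\gamma p}:E\subset\bigcup_{i=1}^\infty B(x_i,r_i),\ x_i\in E,\ r_i\le r\Big\},$$ where the balls have finite positive radii, finite covers are also allowed, and the content of $\emptyset$ is $0$. *)

theory Defs
  imports "HOL-Analysis.Analysis"
begin

text \<open>
  The space \<open>X\<close> is the carrier of a metric type. The measure \<open>\<mu>\<close> is an outer measure, defined on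
  all subsets of \<open>X\<close>. Measurability and integration refer to its restriction to the
  Caratheodory-measurable sets.
\<close>

definition caratheodory_measure :: "('a set \<Rightarrow> ennreal) \<Rightarrow> 'a measure" where
  "caratheodory_measure \<mu> = measure_of UNIV (lambda_system UNIV (Pow UNIV) \<mu>) \<mu>"

lemma
  assumes "outer_measure_space (Pow UNIV) \<mu>"
  shows sets_caratheodory_measure:
      "sets (caratheodory_measure \<mu>) = lambda_system UNIV (Pow UNIV) \<mu>"
    and emeasure_caratheodory_measure:
      "A \<in> lambda_system UNIV (Pow UNIV) \<mu> \<Longrightarrow> emeasure (caratheodory_measure \<mu>) A = \<mu> A"
proof -
  have ms: "measure_space UNIV (lambda_system UNIV (Pow UNIV) \<mu>) \<mu>"
    using sigma_algebra.caratheodory_lemma[OF sigma_algebra_Pow assms] .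
  then interpret sigma_algebra UNIV "lambda_system UNIV (Pow UNIV) \<mu>"
    by (simp add: measure_space_def)
  show "sets (caratheodory_measure \<mu>) = lambda_system UNIV (Pow UNIV) \<mu>"
    unfolding caratheodory_measure_def by (rule sets_measure_of_eq)
  show "emeasure (caratheodory_measure \<mu>) A = \<mu> A"
    if "A \<in> lambda_system UNIV (Pow UNIV) \<mu>"
    using ms that unfolding caratheodory_measure_def measure_space_def
    by (blast intro: emeasure_measure_of_sigma)
qed

definition borel_regular :: "('a::topological_space set \<Rightarrow> ennreal) \<Rightarrow> bool" where
  "borel_regular \<mu> \<longleftrightarrow>
     sets borel \<subseteq> lambda_system UNIV (Pow UNIV) \<mu> \<and>
     (\<forall>A. \<exists>B\<in>sets borel. A \<subseteq> B \<and> \<mu> B = \<mu> A)"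

locale doubling_space =
  fixes \<mu> :: "'a::metric_space set \<Rightarrow> ennreal"
  assumes locally_compact: "locally_compact_space (euclidean :: 'a topology)"
    and outer_measure: "outer_measure_space (Pow UNIV) \<mu>"
    and borel_regular: "borel_regular \<mu>"
    and doubling: "\<exists>c\<ge>1. \<forall>x r. 0 < r \<longrightarrow> \<mu> (ball x (2 * r)) \<le> ennreal c * \<mu> (ball x r)"
    and ball_pos_finite: "\<And>x r. 0 < r \<Longrightarrow> 0 < \<mu> (ball x r) \<and> \<mu> (ball x r) < \<infinity>"
    and sphere_null: "\<And>x r. 0 < r \<Longrightarrow> \<mu> (sphere x r) = 0"
    and point_null: "\<And>x. \<mu> {x} = 0"

definition Lp_space :: "'a measure \<Rightarrow> real \<Rightarrow> ('a \<Rightarrow> real) set" where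
  "Lp_space M p = {f \<in> borel_measurable M. integrable M (\<lambda>x. \<bar>f x\<bar> powr p)}"

definition Lp_norm :: "'a measure \<Rightarrow> real \<Rightarrow> ('a \<Rightarrow> real) \<Rightarrow> real" where
  "Lp_norm M p f = (\<integral>x. \<bar>f x\<bar> powr p \<partial>M) powr (1 / p)"

definition Lp_plus :: "'a measure \<Rightarrow> real \<Rightarrow> ('a \<Rightarrow> real) set" where
  "Lp_plus M p = {f \<in> Lp_space M p. \<forall>x. 0 \<le> f x}"

text \<open>
  The potential of a non-negative function, with values in \<open>[0, \<infinity>]\<close>. For \<open>y \<noteq> x\<close> the ball in the
  kernel has positive radius, so that \<^const>\<open>enn2real\<close> is applied to a finite value.
\<close>

definition riesz_potential ::
    "('a::metric_space set \<Rightarrow> ennreal) \<Rightarrow> real \<Rightarrow> ('a \<Rightarrow> real) \<Rightarrow> 'a \<Rightarrow> ennreal" where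
  "riesz_potential \<mu> \<gamma> f x =
     (\<integral>\<^sup>+y\<in>- {x}. ennreal (f y / enn2real (\<mu> (ball x (dist x y))) powr (1 - \<gamma>))
        \<partial>caratheodory_measure \<mu>)"

definition riesz_admissible ::
    "('a::metric_space set \<Rightarrow> ennreal) \<Rightarrow> real \<Rightarrow> real \<Rightarrow> 'a set \<Rightarrow> ('a \<Rightarrow> real) set" where
  "riesz_admissible \<mu> \<gamma> p E =
     {f \<in> Lp_plus (caratheodory_measure \<mu>) p. \<forall>x\<in>E. 1 \<le> riesz_potential \<mu> \<gamma> f x}"

text \<open>The infimum of the empty set in \<^typ>\<open>ennreal\<close> is \<open>\<infinity>\<close>.\<close>

definition riesz_capacity ::
    "('a::metric_space set \<Rightarrow> ennreal) \<Rightarrow> real \<Rightarrow> real \<Rightarrow> 'a set \<Rightarrow> ennreal" where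
  "riesz_capacity \<mu> \<gamma> p E =
     (INF f\<in>riesz_admissible \<mu> \<gamma> p E. ennreal (Lp_norm (caratheodory_measure \<mu>) p f powr p))"

text \<open>
  Covers are indexed by an arbitrary set \<open>I\<close> of natural numbers, so they may be countably infinite,
  finite or, for \<open>E = {}\<close>, empty. The bound \<open>R\<close> on the radii may be \<open>\<infinity>\<close>.
\<close>

definition hausdorff_content ::
    "('a::metric_space set \<Rightarrow> ennreal) \<Rightarrow> real \<Rightarrow> real \<Rightarrow> ennreal \<Rightarrow> 'a set \<Rightarrow> ennreal" where
  "hausdorff_content \<mu> \<gamma> p R E =
     Inf {(\<Sum>\<^sub>\<infinity>i\<in>I. ennreal (enn2real (\<mu> (ball (x i) (r i))) powr (1 - \<gamma> * p))) |
            (I :: nat set) (x :: nat \<Rightarrow> 'a) (r :: nat \<Rightarrow> real).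
            (\<forall>i\<in>I. x i \<in> E \<and> 0 < r i \<and> ennreal (r i) \<le> R) \<and>
            E \<subseteq> (\<Union>i\<in>I. ball (x i) (r i))}"

end

theory Submission
  imports Defs
begin

text \<open>
  Write \<open>a = \<gamma> p\<close> and \<open>b = \<gamma>' p'\<close>, so that \<open>b < a < 1\<close>. Vanishing capacity supplies, for every
  \<open>\<epsilon> > 0\<close>, a function \<open>f \<ge> 0\<close> with \<open>\<integral> f\<^sup>p \<le> \<epsilon>\<close> whose potential is at least \<open>1\<close> on \<open>E\<close>. The idea is
  that at each point \<open>x\<close> of \<open>E\<close> the measure \<open>f\<^sup>p d\<mu>\<close> must be concentrated: some ball \<open>B = B(x, r)\<close>
  satisfies \<open>\<integral>\<^sub>B f\<^sup>p > t \<mu>(B)\<^bsup>1-b\<^esup>\<close>, with a constant \<open>t\<close> that depends neither on \<open>x\<close> nor on \<open>\<epsilon>\<close>.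

  To see this, cut the potential into dyadic annuli around \<open>x\<close>. By doubling and Hoelder, the annulus
  of outer radius \<open>R\<close> contributes at most a constant times
  \<open>\<mu>(B(x,R))\<^bsup>\<gamma>-1/p\<^esup> (\<integral>\<^bsub>B(x,R)\<^esub> f\<^sup>p)\<^bsup>1/p\<^esup>\<close>. Let \<open>\<rho>\<close> be a radius at which the volume of \<open>B(x,\<rho>)\<close> is about
  \<open>1\<close>; it exists because the growth hypothesis makes volumes tend to \<open>0\<close> and to \<open>\<infinity>\<close>. If the ball at
  \<open>x\<close> never concentrates, then for \<open>R \<le> \<rho>\<close> the contribution is at most a constant times
  \<open>t\<^bsup>1/p\<^esup> \<mu>(B(x,R))\<^bsup>(a-b)/p\<^esup>\<close>, whereas for \<open>R > \<rho>\<close> it is at most a constant times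
  \<open>\<epsilon>\<^bsup>1/p\<^esup> \<mu>(B(x,R))\<^bsup>-(1-a)/p\<^esup>\<close>. Both exponents have the sign that turns the growth hypothesis into
  geometric decay, so the potential at \<open>x\<close> is at most \<open>A t\<^bsup>1/p\<^esup> + A' \<epsilon>\<^bsup>1/p\<^esup>\<close>
  (\<open>riesz_potential_le\<close>). For small \<open>t\<close> and \<open>\<epsilon>\<close> this is less than \<open>1\<close>, a contradiction
  (\<open>exists_concentration_constant\<close>).

  A Vitali selection then extracts disjoint concentrated balls whose enlargements by a fixed factor
  cover \<open>E\<close> (\<open>exists_disjoint_subfamily_meeting_all\<close>). Disjointness gives
  \<open>\<Sum> \<mu>(B\<^sub>i)\<^bsup>1-b\<^esup> \<le> \<epsilon> / t\<close>, and doubling passes this on to the enlarged balls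
  (\<open>hausdorff_content_le_of_concentration\<close>). Letting \<open>\<epsilon>\<close> tend to \<open>0\<close> finishes the proof.
\<close>

section \<open>Integrals, disjoint families and countable covers\<close>

text \<open>
  A form of Hoelder's inequality with the constant \<open>2\<close>. It follows from the pointwise
  bound \<open>f \<le> l + l\<^bsup>1-p\<^esup> f\<^sup>p\<close>, valid for every level \<open>l > 0\<close>: either \<open>f \<le> l\<close>, or \<open>f\<^bsup>1-p\<^esup> \<le> l\<^bsup>1-p\<^esup>\<close>.
\<close>

lemma nn_integral_le_of_powr:
  fixes f :: "'b \<Rightarrow> real"
  assumes f: "f \<in> borel_measurable M" "\<And>x. 0 \<le> f x" and B: "B \<in> sets M"
    and m: "emeasure M B = ennreal m" "0 < m" and p: "1 < p" and T: "0 < T"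
    and le: "(\<integral>\<^sup>+x\<in>B. ennreal (f x powr p) \<partial>M) \<le> ennreal T"
  shows "(\<integral>\<^sup>+x\<in>B. ennreal (f x) \<partial>M) \<le> ennreal (2 * (T powr (1/p) * m powr (1 - 1/p)))"
proof -
  \<comment> \<open>this level balances the two terms: \<open>l * m = l powr (1 - p) * T\<close>\<close>
  define l where "l = (T / m) powr (1/p)"
  have l: "0 < l" using T m by (simp add: l_def)
  have ptw: "f x \<le> l + l powr (1-p) * f x powr p" for x
  proof (cases "f x \<le> l")
    case True
    then show ?thesis by (simp add: add_increasing2)
  next
    case False
    then have fx: "l < f x" "0 < f x" using l by auto
    have "f x = f x powr (1-p) * f x powr p" using fx by (simp flip: powr_add)
    also have "\<dots> \<le> l powr (1-p) * f x powr p"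
      using fx l p by (intro mult_right_mono powr_mono2') auto
    finally show ?thesis using l by linarith
  qed
  have "(\<integral>\<^sup>+x\<in>B. ennreal (f x) \<partial>M)
      \<le> (\<integral>\<^sup>+x. ennreal l * indicator B x
            + ennreal (l powr (1-p)) * (ennreal (f x powr p) * indicator B x) \<partial>M)"
  proof (rule nn_integral_mono)
    fix x
    have "ennreal (f x) \<le> ennreal l + ennreal (l powr (1-p)) * ennreal (f x powr p)"
      using ptw[of x] l by (simp flip: ennreal_mult' ennreal_plus)
    then show "ennreal (f x) * indicator B x \<le> ennreal l * indicator B x
            + ennreal (l powr (1-p)) * (ennreal (f x powr p) * indicator B x)"
      by (auto split: split_indicator)
  qed
  also have "\<dots> = ennreal l * emeasure M B
      + ennreal (l powr (1-p)) * (\<integral>\<^sup>+x\<in>B. ennreal (f x powr p) \<partial>M)"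
    using f(1) B by (simp add: nn_integral_add nn_integral_cmult)
  also have "\<dots> \<le> ennreal l * ennreal m + ennreal (l powr (1-p)) * ennreal T"
    using le by (simp add: m add_left_mono mult_left_mono)
  also have "\<dots> = ennreal (l * m + l powr (1-p) * T)"
    using l m T by (simp add: ennreal_mult' ennreal_plus)
  also have "l * m = T powr (1/p) * m powr (1 - 1/p)"
    using T m by (simp add: l_def powr_divide powr_diff)
  also have "l powr (1-p) * T = T powr (1/p) * m powr (1 - 1/p)"
  proof -
    have "l powr (1-p) = (T/m) powr (1/p - 1)"
      using p by (simp add: l_def powr_powr field_simps)
    also have "\<dots> * T = T powr (1/p) * m powr (1 - 1/p)"
      using T m by (simp add: powr_divide powr_diff)
    finally show ?thesis .
  qed
  finally show ?thesis by (simp only: mult_2)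
qed

text \<open>
  The selection step of the Vitali covering lemma, by Zorn. The size \<open>q\<close> is left abstract
  because balls are selected by volume below: their volumes are bounded, while their radii may not be.
\<close>

lemma exists_disjoint_subfamily_meeting_all:
  fixes q :: "'i \<Rightarrow> real"
  assumes nonempty: "\<And>i. i \<in> E \<Longrightarrow> S i \<noteq> {}"
    and pos: "\<And>i. i \<in> E \<Longrightarrow> 0 < q i" and bound: "\<And>i. i \<in> E \<Longrightarrow> q i \<le> K"
  obtains F where "F \<subseteq> E" "disjoint_family_on S F"
    "\<And>i. i \<in> E \<Longrightarrow> \<exists>j\<in>F. S i \<inter> S j \<noteq> {} \<and> q i \<le> 2 * q j"
proof -
  \<comment> \<open>Besides disjointness: whichever set meets a good family also meets a member of at least half
    its size. This survives unions of chains, and a maximal good family meets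
    everything, since otherwise an almost largest unmet set could be added.\<close>
  define good where "good F \<longleftrightarrow> F \<subseteq> E \<and> disjoint_family_on S F \<and>
     (\<forall>i\<in>E. (\<exists>j\<in>F. S i \<inter> S j \<noteq> {}) \<longrightarrow> (\<exists>j\<in>F. S i \<inter> S j \<noteq> {} \<and> q i \<le> 2 * q j))" for F
  have "\<exists>F\<in>Collect good. \<forall>G\<in>Collect good. F \<subseteq> G \<longrightarrow> G = F"
  proof (rule subset_Zorn)
    fix CC assume "subset.chain (Collect good) CC"
    then have CC: "\<And>G. G \<in> CC \<Longrightarrow> good G"
      and chain: "\<And>G H. G \<in> CC \<Longrightarrow> H \<in> CC \<Longrightarrow> G \<subseteq> H \<or> H \<subseteq> G"
      by (auto simp: subset_chain_def)
    have "good (\<Union>CC)"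
      unfolding good_def
    proof (intro conjI ballI impI)
      show "\<Union>CC \<subseteq> E"
      proof (rule Union_least)
        fix G assume "G \<in> CC"
        then show "G \<subseteq> E" using CC[of G] by (simp add: good_def)
      qed
      show "disjoint_family_on S (\<Union>CC)"
        unfolding disjoint_family_on_def
      proof (intro ballI impI)
        fix i j assume ij: "i \<in> \<Union>CC" "j \<in> \<Union>CC" "i \<noteq> j"
        then obtain G H where GH: "G \<in> CC" "i \<in> G" "H \<in> CC" "j \<in> H" by blast
        have "\<exists>G\<in>CC. i \<in> G \<and> j \<in> G" using chain[OF GH(1,3)] GH by (elim disjE) blast+
        then obtain G where G: "G \<in> CC" "i \<in> G" "j \<in> G" by blast
        then have "disjoint_family_on S G" using CC[OF G(1)] by (simp add: good_def)
        then show "S i \<inter> S j = {}" using G ij(3) by (simp add: disjoint_family_on_def)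
      qed
      fix i assume i: "i \<in> E" "\<exists>j\<in>\<Union>CC. S i \<inter> S j \<noteq> {}"
      then obtain G where G: "G \<in> CC" "\<exists>j\<in>G. S i \<inter> S j \<noteq> {}" by auto
      then have "\<exists>j\<in>G. S i \<inter> S j \<noteq> {} \<and> q i \<le> 2 * q j"
        using CC[OF G(1)] i(1) by (simp add: good_def)
      then show "\<exists>j\<in>\<Union>CC. S i \<inter> S j \<noteq> {} \<and> q i \<le> 2 * q j" using G(1) by blast
    qed
    then show "\<exists>U\<in>Collect good. \<forall>X\<in>CC. X \<subseteq> U" by blast
  qed
  then obtain F where F: "good F" and max: "\<And>G. good G \<Longrightarrow> F \<subseteq> G \<Longrightarrow> G = F" by auto
  define W where "W = {i\<in>E. \<forall>j\<in>F. S i \<inter> S j = {}}"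
  have "W = {}"
  proof (rule ccontr)
    assume W: "W \<noteq> {}"
    have bdd: "bdd_above (q ` W)" using bound by (auto simp: W_def intro!: bdd_aboveI2)
    obtain w0 where w0: "w0 \<in> W" using W by auto
    then have "0 < q w0" using pos by (auto simp: W_def)
    moreover have "q w0 \<le> Sup (q ` W)" using w0 bdd by (auto intro: cSup_upper)
    ultimately have "Sup (q ` W) / 2 < Sup (q ` W)" by linarith
    then obtain w where w: "w \<in> W" "Sup (q ` W) / 2 < q w"
      using W by (subst (asm) less_cSup_iff) (auto simp: bdd)
    have top: "q i \<le> 2 * q w" if "i \<in> W" for i
    proof -
      have "q i \<le> Sup (q ` W)" using that bdd by (auto intro: cSup_upper)
      then show ?thesis using w by linarith
    qed
    have "good (insert w F)"
      unfolding good_def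
    proof (intro conjI ballI impI)
      show "insert w F \<subseteq> E" using F w by (auto simp: good_def W_def)
      show "disjoint_family_on S (insert w F)"
        using F w by (auto simp: good_def W_def disjoint_family_on_def)
      fix i assume i: "i \<in> E" "\<exists>j\<in>insert w F. S i \<inter> S j \<noteq> {}"
      show "\<exists>j\<in>insert w F. S i \<inter> S j \<noteq> {} \<and> q i \<le> 2 * q j"
      proof (cases "i \<in> W")
        case True
        then show ?thesis using i top by (auto simp: W_def)
      next
        case False
        then have "\<exists>j\<in>F. S i \<inter> S j \<noteq> {}" using i(1) by (simp add: W_def)
        then have "\<exists>j\<in>F. S i \<inter> S j \<noteq> {} \<and> q i \<le> 2 * q j"
          using F i(1) by (simp add: good_def)
        then show ?thesis by blast
      qed
    qed
    then have "w \<in> F" using max by blast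
    then show False using w nonempty by (auto simp: W_def)
  qed
  have "\<exists>j\<in>F. S i \<inter> S j \<noteq> {} \<and> q i \<le> 2 * q j" if "i \<in> E" for i
  proof -
    have "\<exists>j\<in>F. S i \<inter> S j \<noteq> {}" using that \<open>W = {}\<close> by (auto simp: W_def)
    then show ?thesis using F that by (simp add: good_def)
  qed
  moreover have "F \<subseteq> E" "disjoint_family_on S F" using F by (simp_all add: good_def)
  ultimately show thesis by (rule that[rotated 2])
qed

lemma suminf_geometric_bound:
  fixes g :: "nat \<Rightarrow> ennreal"
  assumes "\<And>n. g n \<le> ennreal (K * r ^ n)" "0 \<le> K" "0 \<le> r" "r < 1"
  shows "(\<Sum>n. g n) \<le> ennreal (K / (1 - r))"
proof -
  have "(\<Sum>n. g n) \<le> (\<Sum>n. ennreal (K * r ^ n))"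
    using assms by (intro suminf_le) auto
  also have "(\<lambda>n. K * r ^ n) sums (K * (1 / (1 - r)))"
    using assms by (intro sums_mult geometric_sums) auto
  then have "(\<Sum>n. ennreal (K * r ^ n)) = ennreal (K / (1 - r))"
    using assms by (intro sums_unique[symmetric]) (auto simp: sums_ennreal)
  finally show ?thesis .
qed

text \<open>
  Countable covers indexed by their own centres, with the sum controlled on finite subfamilies, are
  as good as covers indexed by natural numbers.
\<close>

lemma hausdorff_content_le:
  fixes F E :: "'a::metric_space set"
  assumes F: "F \<subseteq> E" "countable F" and r: "\<And>y. y \<in> F \<Longrightarrow> 0 < r y"
    and cover: "E \<subseteq> (\<Union>y\<in>F. ball y (r y))"
    and sum: "\<And>G. finite G \<Longrightarrow> G \<subseteq> F \<Longrightarrow>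
       (\<Sum>y\<in>G. ennreal (enn2real (\<mu> (ball y (r y))) powr (1 - \<gamma> * p))) \<le> S"
  shows "hausdorff_content \<mu> \<gamma> p \<infinity> E \<le> S"
proof -
  let ?g = "\<lambda>y. ennreal (enn2real (\<mu> (ball y (r y))) powr (1 - \<gamma> * p))"
  define I where "I = to_nat_on F ` F"
  define x where "x = from_nat_into F"
  have x: "x (to_nat_on F y) = y" if "y \<in> F" for y using that F by (simp add: x_def)
  have "hausdorff_content \<mu> \<gamma> p \<infinity> E \<le> (\<Sum>\<^sub>\<infinity>i\<in>I. ?g (x i))"
    unfolding hausdorff_content_def
  proof (rule Inf_lower, intro CollectI exI conjI)
    show "\<forall>i\<in>I. x i \<in> E \<and> 0 < r (x i) \<and> ennreal (r (x i)) \<le> \<infinity>"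
      using F r by (auto simp: I_def x)
    show "E \<subseteq> (\<Union>i\<in>I. ball (x i) (r (x i)))"
      using cover by (auto simp: I_def x)
  qed auto
  also have "\<dots> = (\<Sum>\<^sub>\<infinity>y\<in>F. ?g (x (to_nat_on F y)))"
    unfolding I_def using inj_on_to_nat_on[OF F(2)] by (simp add: infsum_reindex o_def)
  also have "\<dots> = (\<Sum>\<^sub>\<infinity>y\<in>F. ?g y)" by (intro infsum_cong) (simp add: x)
  also have "\<dots> \<le> S"
  proof (rule infsum_le_finite_sums)
    show "?g summable_on F" by (rule nonneg_summable_on_complete) simp
  qed (rule sum)
  finally show ?thesis .
qed

section \<open>Balls in spaces with upper and lower growth control\<close>

text \<open>
  The constants of the doubling and of the growth hypothesis are parameters, so that the estimates
  below can be stated with explicit constants.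
\<close>

locale reverse_doubling_space = doubling_space \<mu>
  for \<mu> :: "'a::metric_space set \<Rightarrow> ennreal" +
  fixes c C s :: real
  assumes c: "1 \<le> c"
    and doubling_c: "\<And>x r. 0 < r \<Longrightarrow> \<mu> (ball x (2 * r)) \<le> ennreal c * \<mu> (ball x r)"
    and C: "0 < C" and s: "0 < s"
    and reverse: "\<And>y R z r. 0 < R \<Longrightarrow> z \<in> ball y R \<Longrightarrow> 0 < r \<Longrightarrow> r \<le> R \<Longrightarrow>
           \<mu> (ball z r) / \<mu> (ball y R) \<le> ennreal (C * (r / R) powr s)"
begin

abbreviation "M \<equiv> caratheodory_measure \<mu>"

definition vol :: "'a \<Rightarrow> real \<Rightarrow> real" where
  "vol x r = enn2real (\<mu> (ball x r))"

lemma borel_in_M: "A \<in> sets borel \<Longrightarrow> A \<in> sets M"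
  using borel_regular by (auto simp: borel_regular_def sets_caratheodory_measure[OF outer_measure])

lemma space_M [simp]: "space M = UNIV"
  unfolding caratheodory_measure_def by (rule space_measure_of) (auto simp: lambda_system_def)

lemma ball_in_M [measurable]: "ball x r \<in> sets M"
  by (intro borel_in_M) simp

lemma \<mu>_ball: "0 < r \<Longrightarrow> \<mu> (ball x r) = ennreal (vol x r)"
  using ball_pos_finite[of r x] by (simp add: vol_def)

lemma emeasure_ball: "0 < r \<Longrightarrow> emeasure M (ball x r) = ennreal (vol x r)"
  using emeasure_caratheodory_measure[OF outer_measure, of "ball x r"] ball_in_M[of x r]
  by (simp add: \<mu>_ball sets_caratheodory_measure[OF outer_measure])

lemma vol_pos: "0 < r \<Longrightarrow> 0 < vol x r"
  using ball_pos_finite[of r x] by (simp add: vol_def enn2real_positive_iff)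

lemma vol_mono: "0 < r \<Longrightarrow> r \<le> R \<Longrightarrow> vol x r \<le> vol x R"
  using emeasure_mono[of "ball x r" "ball x R" M] vol_pos[of R x]
  by (simp add: emeasure_ball ball_in_M subset_ball)

lemma vol_doubling: "0 < r \<Longrightarrow> vol x (2 * r) \<le> c * vol x r"
  using doubling_c[of r x] c vol_pos[of r x] by (simp add: \<mu>_ball flip: ennreal_mult')

lemma vol_doubling_iter: "0 < r \<Longrightarrow> vol x (2 ^ k * r) \<le> c ^ k * vol x r"
proof (induction k)
  case (Suc k)
  have "vol x (2 ^ Suc k * r) \<le> c * vol x (2 ^ k * r)"
    using vol_doubling[of "2 ^ k * r" x] Suc by (simp add: mult.assoc)
  also have "\<dots> \<le> c * (c ^ k * vol x r)" using Suc c by (intro mult_left_mono) auto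
  finally show ?case by (simp add: mult.assoc)
qed simp

lemma vol_reverse:
  assumes "0 < R" "z \<in> ball y R" "0 < r" "r \<le> R"
  shows "vol z r \<le> C * (r / R) powr s * vol y R"
proof -
  have "ennreal (vol z r / vol y R) \<le> ennreal (C * (r / R) powr s)"
    using reverse[OF assms] vol_pos[of R y] vol_pos[of r z] assms
    by (simp add: \<mu>_ball divide_ennreal)
  then have "vol z r / vol y R \<le> C * (r / R) powr s"
    using C by (subst (asm) ennreal_le_iff) auto
  then show ?thesis using vol_pos[of R y] assms by (simp add: divide_le_eq)
qed

text \<open>
  The growth hypothesis bounds small volumes from above and large ones from below; in particular
  \<open>X\<close> is unbounded and of infinite measure. Hence, when a small radius is doubled repeatedly, there
  is a step at which the volume passes \<open>1\<close>. The radius depends on \<open>x\<close>, which is what makes the constants below uniform in \<open>x\<close>.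
\<close>

lemma exists_unit_radius:
  obtains \<rho> where "0 < \<rho>" "vol x \<rho> \<le> 1" "1 < vol x (2 * \<rho>)"
proof -
  define v where "v = vol x 1"
  have v: "0 < v" by (simp add: v_def vol_pos)
  \<comment> \<open>chosen so that the growth bound \<open>C * r powr s * v\<close> for \<open>vol x r\<close> is at most \<open>1\<close>\<close>
  define r where "r = min 1 ((1 / (C * v)) powr (1/s))"
  have r: "0 < r" "r \<le> 1" using v C by (auto simp: r_def)
  have "r powr s \<le> ((1 / (C * v)) powr (1/s)) powr s"
    using r s by (intro powr_mono2) (auto simp: r_def)
  also have "\<dots> = 1 / (C * v)" using s C v by (simp add: powr_powr)
  finally have rs: "r powr s \<le> 1 / (C * v)" .
  have "vol x r \<le> C * (r / 1) powr s * v"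
    unfolding v_def using r by (intro vol_reverse) auto
  also have "\<dots> \<le> C * (1 / (C * v)) * v"
    using rs C v by (intro mult_right_mono mult_left_mono) auto
  also have "\<dots> = 1" using C v by simp
  finally have small: "vol x r \<le> 1" .
  have "\<exists>n. 1 < vol x (r * 2 ^ n)"
  proof -
    define w where "w = vol x r"
    have w: "0 < w" using r by (simp add: w_def vol_pos)
    obtain n where n: "(C / w) powr (1/s) < 2 ^ n" using real_arch_pow[of 2] by auto
    have "C / w = ((C / w) powr (1/s)) powr s" using s C w by (simp add: powr_powr)
    also have "\<dots> < (2 ^ n) powr s" using n s by (intro powr_less_mono2) auto
    finally have big: "C < (2 ^ n) powr s * w" using w by (simp add: field_simps)
    have "w \<le> C * (r / (r * 2 ^ n)) powr s * vol x (r * 2 ^ n)"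
      unfolding w_def using r by (intro vol_reverse) auto
    also have "r / (r * 2 ^ n) = 1 / 2 ^ n" using r by simp
    also have "C * (1 / 2 ^ n) powr s * vol x (r * 2 ^ n) = C * vol x (r * 2 ^ n) / (2 ^ n) powr s"
      by (simp add: powr_divide)
    finally have "(2 ^ n) powr s * w \<le> C * vol x (r * 2 ^ n)" by (simp add: field_simps)
    with big have "C * 1 < C * vol x (r * 2 ^ n)" by linarith
    then show ?thesis using C by (auto simp: mult_less_cancel_left_pos)
  qed
  then obtain n where n: "1 < vol x (r * 2 ^ n)" "\<And>k. k < n \<Longrightarrow> \<not> 1 < vol x (r * 2 ^ k)"
    using exists_least_iff[of "\<lambda>n. 1 < vol x (r * 2 ^ n)"] by blast
  with small have "n \<noteq> 0" by (cases n) auto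
  then obtain k where k: "n = Suc k" by (cases n) auto
  show thesis
    using n(1) n(2)[of k] r by (intro that[of "r * 2 ^ k"]) (auto simp: k mult.left_commute)
qed

text \<open>
  The selection lemma compares volumes; this converts the comparison into one of radii. If \<open>r\<close> were
  much larger than \<open>r'\<close>, then \<open>B(y,r')\<close> would sit at a small scale inside \<open>B(x,2r)\<close> and the growth
  hypothesis would make its volume much smaller than that of \<open>B(x,r)\<close>.
\<close>

lemma intersecting_radius_bound:
  assumes r: "0 < r" "0 < r'" and meet: "ball x r \<inter> ball y r' \<noteq> {}"
    and q: "vol x r \<le> 2 * vol y r'"
  shows "r \<le> max 1 ((2 * C * c) powr (1/s)) * r'"
proof (rule ccontr)
  define L where "L = max 1 ((2 * C * c) powr (1/s))"
  have L: "1 \<le> L" by (simp add: L_def)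
  assume "\<not> ?thesis"
  then have less: "L * r' < r" by (simp add: L_def)
  have "1 * r' \<le> L * r'" using L r by (intro mult_right_mono) auto
  then have rr: "r' < r" using less by linarith
  have "dist x y < r + r'"
  proof -
    obtain w where "dist x w < r" "dist y w < r'" using meet by auto
    then show ?thesis using dist_triangle2[of x y w] by linarith
  qed
  then have "y \<in> ball x (2 * r)" using rr by simp
  then have "vol y r' \<le> C * (r' / (2 * r)) powr s * vol x (2 * r)"
    using r rr by (intro vol_reverse) auto
  also have "\<dots> \<le> C * (r' / (2 * r)) powr s * (c * (2 * vol y r'))"
    using vol_doubling[of r x] q r C c
    by (intro mult_left_mono) (auto intro: order_trans mult_left_mono)
  also have "\<dots> = (2 * C * c * (r' / (2 * r)) powr s) * vol y r'" by simp
  finally have "1 \<le> 2 * C * c * (r' / (2 * r)) powr s"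
    using vol_pos[of r' y] r by simp
  also have "\<dots> < 2 * C * c * (1 / L) powr s"
  proof -
    have "L * r' < 2 * r" using less r by linarith
    then have "r' / (2 * r) < 1 / L" using r L by (simp add: field_simps)
    then show ?thesis
      using r s C c by (intro mult_strict_left_mono powr_less_mono2) auto
  qed
  also have "(1 / L) powr s \<le> 1 / (2 * C * c)"
  proof -
    have "2 * C * c = ((2 * C * c) powr (1/s)) powr s" using s C c by (simp add: powr_powr)
    also have "\<dots> \<le> L powr s" using s by (intro powr_mono2) (auto simp: L_def)
    finally show ?thesis using L C c by (simp add: powr_divide frac_le)
  qed
  then have "2 * C * c * (1 / L) powr s \<le> 1" using C c by (simp add: field_simps)
  finally show False by simp
qed

section \<open>The potential of a function of small local energy\<close>

lemma exists_dyadic_below: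
  assumes "0 < d" "d < (\<rho>::real)"
  obtains n where "\<rho> / 2 ^ n / 2 \<le> d" "d < \<rho> / 2 ^ n"
proof -
  obtain m where "\<rho> / d < 2 ^ m" using real_arch_pow[of 2] by auto
  then have "\<rho> / 2 ^ m / 2 \<le> d" using assms by (simp add: field_simps)
  then obtain n where n: "\<rho> / 2 ^ n / 2 \<le> d" "\<And>k. k < n \<Longrightarrow> \<not> \<rho> / 2 ^ k / 2 \<le> d"
    using exists_least_iff[of "\<lambda>n. \<rho> / 2 ^ n / 2 \<le> d"] by blast
  have "d < \<rho> / 2 ^ n"
  proof (cases n)
    case (Suc k)
    then show ?thesis using n(2)[of k] by simp
  qed (use assms in simp)
  with n(1) show thesis by (rule that)
qed

lemma exists_dyadic_above:
  assumes "0 < \<rho>" "\<rho> \<le> (d::real)"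
  obtains n where "\<rho> * 2 ^ n \<le> d" "d < 2 * (\<rho> * 2 ^ n)"
proof -
  obtain m where "d / \<rho> < 2 ^ m" using real_arch_pow[of 2] by auto
  then have "d < \<rho> * 2 ^ m" using assms by (simp add: field_simps)
  also have "\<dots> \<le> 2 * (\<rho> * 2 ^ m)" using assms by simp
  finally obtain n where n: "d < 2 * (\<rho> * 2 ^ n)" "\<And>k. k < n \<Longrightarrow> \<not> d < 2 * (\<rho> * 2 ^ k)"
    using exists_least_iff[of "\<lambda>n. d < 2 * (\<rho> * 2 ^ n)"] by blast
  have "\<rho> * 2 ^ n \<le> d"
  proof (cases n)
    case (Suc k)
    then show ?thesis using n(2)[of k] by simp
  qed (use assms in simp)
  then show thesis using n(1) by (rule that)
qed

text \<open>
  On the annulus \<open>R/2 \<le> d(x,y) < R\<close> the kernel is at most its value at distance \<open>R/2\<close>, and there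
  the integral of \<open>f\<close> may be enlarged to the whole ball. The radii \<open>\<rho> / 2\<^sup>n\<close> exhaust the punctured
  ball \<open>B(x,\<rho>)\<close>, the radii \<open>2\<^bsup>n+1\<^esup> \<rho>\<close> its complement.
\<close>

lemma riesz_potential_le_dyadic:
  fixes f :: "'a \<Rightarrow> real" and x :: 'a
  assumes f: "f \<in> borel_measurable M" "\<And>y. 0 \<le> f y" and \<rho>: "0 < \<rho>" and \<gamma>: "\<gamma> < 1"
  defines "k \<equiv> \<lambda>R. ennreal (vol x (R/2) powr (\<gamma> - 1)) * (\<integral>\<^sup>+y\<in>ball x R. ennreal (f y) \<partial>M)"
  shows "riesz_potential \<mu> \<gamma> f x \<le> (\<Sum>n. k (\<rho> / 2 ^ n)) + (\<Sum>n. k (2 * (\<rho> * 2 ^ n)))"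
proof -
  define h where "h R y = ennreal (vol x (R/2) powr (\<gamma> - 1)) * (ennreal (f y) * indicator (ball x R) y)"
    for R y
  have h_meas [measurable]: "h R \<in> borel_measurable M" for R
    unfolding h_def using f(1) by measurable
  have kernel: "ennreal (f y / vol x (dist x y) powr (1 - \<gamma>)) \<le> h R y"
    if "0 < R" "R / 2 \<le> dist x y" "dist x y < R" for R y
  proof -
    have "f y / vol x (dist x y) powr (1 - \<gamma>) \<le> f y / vol x (R/2) powr (1 - \<gamma>)"
      using f(2) that \<gamma> vol_pos[of "R/2" x] vol_mono[of "R/2" "dist x y" x]
      by (intro divide_left_mono powr_mono2 mult_pos_pos) auto
    also have "\<dots> = vol x (R/2) powr (\<gamma> - 1) * f y"
      using powr_minus_divide[of "vol x (R/2)" "1 - \<gamma>"] by simp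
    finally show ?thesis using that f(2) by (simp add: h_def flip: ennreal_mult')
  qed
  have "riesz_potential \<mu> \<gamma> f x \<le> (\<integral>\<^sup>+y. (\<Sum>n. h (\<rho> / 2 ^ n) y) + (\<Sum>n. h (2 * (\<rho> * 2 ^ n)) y) \<partial>M)"
    unfolding riesz_potential_def
  proof (rule nn_integral_mono)
    fix y
    show "ennreal (f y / enn2real (\<mu> (ball x (dist x y))) powr (1 - \<gamma>)) * indicator (- {x}) y
        \<le> (\<Sum>n. h (\<rho> / 2 ^ n) y) + (\<Sum>n. h (2 * (\<rho> * 2 ^ n)) y)"
    proof (cases "y = x")
      case False
      have term_le: "g n \<le> (\<Sum>n. g n)" for g :: "nat \<Rightarrow> ennreal" and n
        using sum_le_suminf[of g "{n}"] by simp
      show ?thesis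
      proof (cases "dist x y < \<rho>")
        case True
        then obtain n where n: "\<rho> / 2 ^ n / 2 \<le> dist x y" "dist x y < \<rho> / 2 ^ n"
          using exists_dyadic_below[of "dist x y" \<rho>] \<open>y \<noteq> x\<close> by auto
        have "ennreal (f y / vol x (dist x y) powr (1 - \<gamma>)) \<le> h (\<rho> / 2 ^ n) y"
          using n \<rho> by (intro kernel) auto
        also have "\<dots> \<le> (\<Sum>n. h (\<rho> / 2 ^ n) y)" by (rule term_le)
        finally show ?thesis using False by (simp add: vol_def add_increasing2)
      next
        case far: False
        then obtain n where n: "\<rho> * 2 ^ n \<le> dist x y" "dist x y < 2 * (\<rho> * 2 ^ n)"
          using exists_dyadic_above[of \<rho> "dist x y"] \<rho> by auto
        have "ennreal (f y / vol x (dist x y) powr (1 - \<gamma>)) \<le> h (2 * (\<rho> * 2 ^ n)) y"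
          using n \<rho> by (intro kernel) auto
        also have "\<dots> \<le> (\<Sum>n. h (2 * (\<rho> * 2 ^ n)) y)" by (rule term_le)
        finally show ?thesis using False by (simp add: vol_def add_increasing)
      qed
    qed simp
  qed
  also have "\<dots> = (\<Sum>n. k (\<rho> / 2 ^ n)) + (\<Sum>n. k (2 * (\<rho> * 2 ^ n)))"
  proof -
    have "(\<integral>\<^sup>+y. h R y \<partial>M) = k R" for R
      unfolding h_def k_def using f(1) ball_in_M[of x R] by (intro nn_integral_cmult) auto
    then show ?thesis by (simp add: nn_integral_add nn_integral_suminf)
  qed
  finally show ?thesis .
qed

lemma two_powr_less_1: "0 < e \<Longrightarrow> 2 powr (- s * e) < 1"
  using s powr_less_mono[of "- s * e" 0 2] by simp

text \<open>Hoelder on the ball, with doubling to replace the volume at radius \<open>R/2\<close> by that at \<open>R\<close>.\<close>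

lemma dyadic_term_le:
  fixes f :: "'a \<Rightarrow> real"
  assumes f: "f \<in> borel_measurable M" "\<And>y. 0 \<le> f y" and R: "0 < R"
    and \<gamma>: "0 < \<gamma>" "\<gamma> < 1" and p: "1 < p" and T: "0 < T"
    and le: "(\<integral>\<^sup>+y\<in>ball x R. ennreal (f y powr p) \<partial>M) \<le> ennreal T"
  shows "ennreal (vol x (R/2) powr (\<gamma> - 1)) * (\<integral>\<^sup>+y\<in>ball x R. ennreal (f y) \<partial>M)
      \<le> ennreal (2 * c * T powr (1/p) * vol x R powr (\<gamma> - 1/p))"
proof -
  have v: "0 < vol x R" "0 < vol x (R/2)" using R by (auto simp: vol_pos)
  have d: "vol x R \<le> c * vol x (R/2)" using vol_doubling[of "R/2" x] R by simp
  have "vol x (R/2) powr (\<gamma> - 1) \<le> (vol x R / c) powr (\<gamma> - 1)"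
    using d v \<gamma> c by (intro powr_mono2') (auto simp: field_simps)
  also have "\<dots> = c powr (1 - \<gamma>) * vol x R powr (\<gamma> - 1)"
    using v c powr_minus_divide[of c "\<gamma> - 1"] by (simp add: powr_divide)
  also have "\<dots> \<le> c * vol x R powr (\<gamma> - 1)"
    using powr_mono[of "1 - \<gamma>" 1 c] c \<gamma> by (intro mult_right_mono) auto
  finally have coeff: "vol x (R/2) powr (\<gamma> - 1) \<le> c * vol x R powr (\<gamma> - 1)" .
  have "ennreal (vol x (R/2) powr (\<gamma> - 1)) * (\<integral>\<^sup>+y\<in>ball x R. ennreal (f y) \<partial>M)
     \<le> ennreal (c * vol x R powr (\<gamma> - 1)) * ennreal (2 * (T powr (1/p) * vol x R powr (1 - 1/p)))"
    using v R by (intro mult_mono ennreal_leI coeff nn_integral_le_of_powr[OF f _ _ _ p T le])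
      (auto simp: emeasure_ball ball_in_M)
  also have "\<dots> = ennreal (2 * c * T powr (1/p) * (vol x R powr (\<gamma> - 1) * vol x R powr (1 - 1/p)))"
    using c by (simp add: mult_ac flip: ennreal_mult')
  also have "vol x R powr (\<gamma> - 1) * vol x R powr (1 - 1/p) = vol x R powr (\<gamma> - 1/p)"
    by (simp flip: powr_add)
  finally show ?thesis .
qed

text \<open>
  The local bound is used for radii up to \<open>\<rho>\<close>, where it leaves the positive power
  \<open>\<gamma> - b/p\<close> of a volume that decays geometrically; the global bound is used beyond \<open>\<rho>\<close>, where it
  leaves the negative power \<open>\<gamma> - 1/p\<close> of a volume that grows geometrically.
\<close>

lemma riesz_potential_le:
  fixes f :: "'a \<Rightarrow> real"
  assumes f: "f \<in> borel_measurable M" "\<And>y. 0 \<le> f y"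
    and \<gamma>: "0 < \<gamma>" "\<gamma> < 1" and p: "1 < p" and b: "b < \<gamma> * p" "\<gamma> * p < 1"
    and t: "0 < t" and \<epsilon>: "0 < \<epsilon>"
    and loc: "\<And>r. 0 < r \<Longrightarrow>
      (\<integral>\<^sup>+y\<in>ball x r. ennreal (f y powr p) \<partial>M) \<le> ennreal (t * vol x r powr (1 - b))"
    and glob: "(\<integral>\<^sup>+y. ennreal (f y powr p) \<partial>M) \<le> ennreal \<epsilon>"
  shows "riesz_potential \<mu> \<gamma> f x \<le>
     ennreal (2 * c * t powr (1/p) * C powr (\<gamma> - b/p) / (1 - 2 powr (- s * (\<gamma> - b/p)))
       + 2 * c * \<epsilon> powr (1/p) * C powr (1/p - \<gamma>) / (1 - 2 powr (- s * (1/p - \<gamma>))))"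
proof -
  obtain \<rho> where \<rho>: "0 < \<rho>" "vol x \<rho> \<le> 1" "1 < vol x (2 * \<rho>)" by (rule exists_unit_radius)
  define e where "e = \<gamma> - b/p"
  define e' where "e' = 1/p - \<gamma>"
  have e: "0 < e" "0 < e'" using b p by (auto simp: e_def e'_def field_simps)
  define k where "k = (\<lambda>R. ennreal (vol x (R/2) powr (\<gamma> - 1)) * (\<integral>\<^sup>+y\<in>ball x R. ennreal (f y) \<partial>M))"
  have two: "((1::real) / 2 ^ n) powr (s * u) = (2 powr (- s * u)) ^ n" for n u
  proof -
    have "(1::real) / 2 ^ n = 2 powr (- real n)" by (simp add: powr_minus_divide powr_realpow)
    then show ?thesis by (simp add: powr_powr powr_power mult_ac)
  qed
  have "(\<Sum>n. k (\<rho> / 2 ^ n)) \<le> ennreal ((2 * c * t powr (1/p) * C powr e) / (1 - 2 powr (- s * e)))"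
  proof (rule suminf_geometric_bound)
    fix n
    define R where "R = \<rho> / 2 ^ n"
    have R: "0 < R" using \<rho> by (simp add: R_def)
    have v: "0 < vol x R" using R by (rule vol_pos)
    have "k R \<le> ennreal (2 * c * (t * vol x R powr (1 - b)) powr (1/p) * vol x R powr (\<gamma> - 1/p))"
      unfolding k_def using v t R by (intro dyadic_term_le f \<gamma> p loc) auto
    also have "\<dots> \<le> ennreal (2 * c * t powr (1/p) * C powr e * (2 powr (- s * e)) ^ n)"
    proof (rule ennreal_leI)
      have "(1 - b) * (1/p) + (\<gamma> - 1/p) = e" using p by (simp add: e_def field_simps)
      then have "vol x R powr ((1 - b) * (1/p)) * vol x R powr (\<gamma> - 1/p) = vol x R powr e"
        by (simp only: powr_add[symmetric])
      then have split: "2 * c * (t * vol x R powr (1 - b)) powr (1/p) * vol x R powr (\<gamma> - 1/p)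
          = 2 * c * t powr (1/p) * vol x R powr e"
        using t v by (simp add: powr_mult powr_powr)
      have "vol x R \<le> C * (R / \<rho>) powr s * vol x \<rho>"
        using \<rho> R by (intro vol_reverse) (auto simp: R_def field_simps)
      also have "\<dots> \<le> C * (1 / 2 ^ n) powr s"
        using \<rho> C by (simp add: R_def mult_left_le)
      finally have "vol x R powr e \<le> (C * (1 / 2 ^ n) powr s) powr e"
        using e v by (intro powr_mono2) auto
      also have "\<dots> = C powr e * (1 / 2 ^ n) powr (s * e)"
        using C by (simp add: powr_mult powr_powr)
      finally have "vol x R powr e \<le> C powr e * (2 powr (- s * e)) ^ n" by (simp only: two)
      then show "2 * c * (t * vol x R powr (1 - b)) powr (1/p) * vol x R powr (\<gamma> - 1/p)
          \<le> 2 * c * t powr (1/p) * C powr e * (2 powr (- s * e)) ^ n"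
        unfolding split using c by (simp add: mult.assoc mult_left_mono)
    qed
    finally show "k (\<rho> / 2 ^ n) \<le> ennreal (2 * c * t powr (1/p) * C powr e * (2 powr (- s * e)) ^ n)"
      by (simp only: R_def)
  qed (use c two_powr_less_1[OF e(1)] in \<open>simp_all del: mult_minus_left\<close>)
  moreover
  have "(\<Sum>n. k (2 * (\<rho> * 2 ^ n))) \<le> ennreal ((2 * c * \<epsilon> powr (1/p) * C powr e') / (1 - 2 powr (- s * e')))"
  proof (rule suminf_geometric_bound)
    fix n
    define R where "R = 2 * (\<rho> * 2 ^ n)"
    have R: "0 < R" using \<rho> by (simp add: R_def)
    have v: "0 < vol x R" using R by (rule vol_pos)
    have "(\<integral>\<^sup>+y\<in>ball x R. ennreal (f y powr p) \<partial>M) \<le> (\<integral>\<^sup>+y. ennreal (f y powr p) \<partial>M)"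
      by (intro nn_integral_mono) (auto split: split_indicator)
    with glob have "k R \<le> ennreal (2 * c * \<epsilon> powr (1/p) * vol x R powr (\<gamma> - 1/p))"
      unfolding k_def using \<epsilon> R by (intro dyadic_term_le f \<gamma> p) auto
    also have "\<dots> \<le> ennreal (2 * c * \<epsilon> powr (1/p) * C powr e' * (2 powr (- s * e')) ^ n)"
    proof (rule ennreal_leI)
      have "1 < vol x (2 * \<rho>)" by fact
      also have "\<dots> \<le> C * (2 * \<rho> / R) powr s * vol x R"
        using \<rho> R by (intro vol_reverse) (auto simp: R_def)
      also have "2 * \<rho> / R = 1 / 2 ^ n" using \<rho> by (simp add: R_def)
      finally have "1 / vol x R \<le> C * (1 / 2 ^ n) powr s" using v by (simp add: divide_le_eq)
      then have "(1 / vol x R) powr e' \<le> (C * (1 / 2 ^ n) powr s) powr e'"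
        using e v by (intro powr_mono2) auto
      also have "\<dots> = C powr e' * (1 / 2 ^ n) powr (s * e')"
        using C by (simp add: powr_mult powr_powr)
      also have "(1 / vol x R) powr e' = vol x R powr (\<gamma> - 1/p)"
        using v powr_minus_divide[of "vol x R" e'] by (simp add: powr_divide e'_def)
      finally have "vol x R powr (\<gamma> - 1/p) \<le> C powr e' * (2 powr (- s * e')) ^ n" by (simp only: two)
      then show "2 * c * \<epsilon> powr (1/p) * vol x R powr (\<gamma> - 1/p)
          \<le> 2 * c * \<epsilon> powr (1/p) * C powr e' * (2 powr (- s * e')) ^ n"
        using c by (simp add: mult.assoc mult_left_mono)
    qed
    finally show "k (2 * (\<rho> * 2 ^ n)) \<le> ennreal (2 * c * \<epsilon> powr (1/p) * C powr e' * (2 powr (- s * e')) ^ n)"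
      by (simp only: R_def)
  qed (use c two_powr_less_1[OF e(2)] in \<open>simp_all del: mult_minus_left\<close>)
  ultimately have "(\<Sum>n. k (\<rho> / 2 ^ n)) + (\<Sum>n. k (2 * (\<rho> * 2 ^ n))) \<le>
      ennreal ((2 * c * t powr (1/p) * C powr e) / (1 - 2 powr (- s * e)))
    + ennreal ((2 * c * \<epsilon> powr (1/p) * C powr e') / (1 - 2 powr (- s * e')))"
    by (rule add_mono)
  also have "\<dots> = ennreal ((2 * c * t powr (1/p) * C powr e) / (1 - 2 powr (- s * e))
       + (2 * c * \<epsilon> powr (1/p) * C powr e') / (1 - 2 powr (- s * e')))"
    using c two_powr_less_1[OF e(1)] two_powr_less_1[OF e(2)]
    by (intro ennreal_plus[symmetric] divide_nonneg_nonneg) (simp_all del: mult_minus_left)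
  finally show ?thesis
    using riesz_potential_le_dyadic[OF f \<rho>(1) \<gamma>(2), of x]
    unfolding k_def e_def e'_def by (rule order_trans[rotated])
qed

text \<open>
  Contrapositive of the previous bound: \<open>t\<close> and \<open>\<epsilon>\<close> are chosen so that each of its two summands
  equals \<open>1/4\<close>.
\<close>

lemma exists_concentration_constant:
  assumes \<gamma>: "0 < \<gamma>" "\<gamma> < 1" and p: "1 < p" and b: "b < \<gamma> * p" "\<gamma> * p < 1"
  shows "\<exists>t>0. \<exists>\<epsilon>>0. \<forall>f x. f \<in> borel_measurable M \<longrightarrow> (\<forall>y. 0 \<le> f y) \<longrightarrow>
    (\<integral>\<^sup>+y. ennreal (f y powr p) \<partial>M) \<le> ennreal \<epsilon> \<longrightarrow> 1 \<le> riesz_potential \<mu> \<gamma> f x \<longrightarrow>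
    (\<exists>r>0. ennreal (t * vol x r powr (1 - b)) < (\<integral>\<^sup>+y\<in>ball x r. ennreal (f y powr p) \<partial>M))"
proof -
  define A where "A = 2 * c * C powr (\<gamma> - b/p) / (1 - 2 powr (- s * (\<gamma> - b/p)))"
  define A' where "A' = 2 * c * C powr (1/p - \<gamma>) / (1 - 2 powr (- s * (1/p - \<gamma>)))"
  have e: "0 < \<gamma> - b/p" "0 < 1/p - \<gamma>" using b p by (auto simp: field_simps)
  have A: "0 < A" "0 < A'"
    unfolding A_def A'_def using c C two_powr_less_1[OF e(1)] two_powr_less_1[OF e(2)]
    by (simp_all del: mult_minus_left)
  have eqA: "2 * c * z * C powr (\<gamma> - b/p) / (1 - 2 powr (- s * (\<gamma> - b/p))) = A * z" for z
    unfolding A_def times_divide_eq_left by (simp only: mult_ac)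
  have eqA': "2 * c * z * C powr (1/p - \<gamma>) / (1 - 2 powr (- s * (1/p - \<gamma>))) = A' * z" for z
    unfolding A'_def times_divide_eq_left by (simp only: mult_ac)
  define t where "t = (1 / (4 * A)) powr p"
  define \<epsilon> where "\<epsilon> = (1 / (4 * A')) powr p"
  have t: "0 < t" and \<epsilon>: "0 < \<epsilon>" using A by (auto simp: t_def \<epsilon>_def)
  have root: "t powr (1/p) = 1 / (4 * A)" "\<epsilon> powr (1/p) = 1 / (4 * A')"
    using p A by (simp_all add: t_def \<epsilon>_def powr_powr)
  show ?thesis
  proof (rule exI[of _ t], rule conjI[OF t], rule exI[of _ \<epsilon>], rule conjI[OF \<epsilon>], intro allI impI)
    fix f x
    assume f: "f \<in> borel_measurable M" and "\<forall>y. 0 \<le> f y"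
      and small: "(\<integral>\<^sup>+y. ennreal (f y powr p) \<partial>M) \<le> ennreal \<epsilon>"
      and one: "1 \<le> riesz_potential \<mu> \<gamma> f x"
    then have f0: "0 \<le> f y" for y by blast
    show "\<exists>r>0. ennreal (t * vol x r powr (1 - b)) < (\<integral>\<^sup>+y\<in>ball x r. ennreal (f y powr p) \<partial>M)"
  proof (rule ccontr)
    assume no: "\<not> ?thesis"
    have loc: "(\<integral>\<^sup>+y\<in>ball x r. ennreal (f y powr p) \<partial>M) \<le> ennreal (t * vol x r powr (1 - b))"
      if "0 < r" for r
      using no that by (meson linorder_not_le)
    note one
    also have "riesz_potential \<mu> \<gamma> f x \<le> ennreal (A * t powr (1/p) + A' * \<epsilon> powr (1/p))"
      using riesz_potential_le[OF f f0 \<gamma> p b t \<epsilon> loc small] unfolding eqA eqA' .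
    also have "\<dots> = ennreal (A * (1 / (4 * A)) + A' * (1 / (4 * A')))"
      by (simp only: root)
    also have "A * (1 / (4 * A)) + A' * (1 / (4 * A')) = 1 / 2" using A by simp
    finally have "ennreal 1 \<le> ennreal (1 / 2)" by (simp only: ennreal_1)
    then show False by (subst (asm) ennreal_le_iff) auto
  qed
  qed
qed

section \<open>From concentration to small covers\<close>

text \<open>
  In the application \<open>\<nu>\<close> is \<open>f\<^sup>p d\<mu>\<close>. The finite mass of \<open>\<nu>\<close> serves three times: it bounds the volumes of
  the concentrated balls, so that a disjoint subfamily can be selected; it makes that subfamily
  countable; and it bounds the sum of the volumes to the power \<open>1 - \<gamma>' p'\<close>.
\<close>

lemma hausdorff_content_le_of_concentration:
  assumes nu: "sets \<nu> = sets M" "emeasure \<nu> UNIV \<le> ennreal \<epsilon>" and pos: "0 < t" "0 < \<epsilon>"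
    and b: "\<gamma>' * p' < 1"
    and conc: "\<And>x. x \<in> E \<Longrightarrow> \<exists>r>0. ennreal (t * vol x r powr (1 - \<gamma>' * p')) < emeasure \<nu> (ball x r)"
    and k: "max 1 ((2 * C * c) powr (1/s)) + 1 \<le> 2 ^ k"
  shows "hausdorff_content \<mu> \<gamma>' p' \<infinity> E \<le> ennreal ((c ^ k) powr (1 - \<gamma>' * p') * \<epsilon> / t)"
proof -
  define \<theta> where "\<theta> = 1 - \<gamma>' * p'"
  have \<theta>: "0 < \<theta>" using b by (simp add: \<theta>_def)
  define L where "L = max 1 ((2 * C * c) powr (1/s))"
  obtain r where r: "\<And>x. x \<in> E \<Longrightarrow> 0 < r x"
    "\<And>x. x \<in> E \<Longrightarrow> ennreal (t * vol x (r x) powr \<theta>) < emeasure \<nu> (ball x (r x))"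
    using conc unfolding \<theta>_def by metis
  have nu_ball: "ball x d \<in> sets \<nu>" for x d using nu by simp
  have space: "space \<nu> = UNIV" using sets_eq_imp_space_eq[OF nu(1)] by simp
  have bounded: "vol x (r x) \<le> (\<epsilon> / t) powr (1/\<theta>)" if "x \<in> E" for x
  proof -
    have "ennreal (t * vol x (r x) powr \<theta>) \<le> emeasure \<nu> (ball x (r x))"
      using r(2)[OF that] by simp
    also have "\<dots> \<le> emeasure \<nu> UNIV" using emeasure_space[of \<nu>] space by simp
    also note nu(2)
    finally have "vol x (r x) powr \<theta> \<le> \<epsilon> / t" using pos by (simp add: field_simps)
    then have "(vol x (r x) powr \<theta>) powr (1/\<theta>) \<le> (\<epsilon> / t) powr (1/\<theta>)"
      using \<theta> by (intro powr_mono2) auto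
    then show ?thesis using \<theta> vol_pos[OF r(1)[OF that], of x] by (simp add: powr_powr)
  qed
  obtain F where F: "F \<subseteq> E" "disjoint_family_on (\<lambda>x. ball x (r x)) F"
    and meet: "\<And>x. x \<in> E \<Longrightarrow> \<exists>y\<in>F. ball x (r x) \<inter> ball y (r y) \<noteq> {} \<and> vol x (r x) \<le> 2 * vol y (r y)"
    by (rule exists_disjoint_subfamily_meeting_all
        [of E "\<lambda>x. ball x (r x)" "\<lambda>x. vol x (r x)" "(\<epsilon> / t) powr (1/\<theta>)"])
      (simp_all add: r(1) bounded vol_pos not_le)
  have packing: "(\<Sum>y\<in>G. vol y (r y) powr \<theta>) \<le> \<epsilon> / t" if G: "finite G" "G \<subseteq> F" for G
  proof -
    have "ennreal (\<Sum>y\<in>G. t * vol y (r y) powr \<theta>) = (\<Sum>y\<in>G. ennreal (t * vol y (r y) powr \<theta>))"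
      using pos by (intro sum_ennreal[symmetric]) auto
    also have "\<dots> \<le> (\<Sum>y\<in>G. emeasure \<nu> (ball y (r y)))"
      using r(2) F G by (intro sum_mono) (auto intro: less_imp_le)
    also have "\<dots> = emeasure \<nu> (\<Union>y\<in>G. ball y (r y))"
      using F G nu_ball by (intro sum_emeasure) (auto simp: disjoint_family_on_def)
    also have "\<dots> \<le> emeasure \<nu> UNIV" using emeasure_space[of \<nu>] space by simp
    also note nu(2)
    finally have "t * (\<Sum>y\<in>G. vol y (r y) powr \<theta>) \<le> \<epsilon>"
      using pos by (simp add: sum_distrib_left)
    then show ?thesis using pos by (simp add: field_simps)
  qed
  have "(\<lambda>y. vol y (r y) powr \<theta>) summable_on F"
    by (rule nonneg_bdd_above_summable_on) (auto intro!: bdd_aboveI2 packing)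
  then have "countable {y\<in>F. vol y (r y) powr \<theta> \<noteq> 0}"
    using summable_countable_real by blast
  moreover have "vol y (r y) \<noteq> 0" if "y \<in> F" for y
    using vol_pos[OF r(1), of y y] F(1) that by auto
  then have "{y\<in>F. vol y (r y) powr \<theta> \<noteq> 0} = F" by auto
  ultimately have "countable F" by simp
  show ?thesis
  proof (rule hausdorff_content_le[OF F(1) \<open>countable F\<close>])
    show "0 < 2 ^ k * r y" if "y \<in> F" for y using that F r by auto
    show "E \<subseteq> (\<Union>y\<in>F. ball y (2 ^ k * r y))"
    proof
      fix x assume x: "x \<in> E"
      obtain y where y: "y \<in> F" "ball x (r x) \<inter> ball y (r y) \<noteq> {}" "vol x (r x) \<le> 2 * vol y (r y)"
        using meet[OF x] by auto
      have ry: "0 < r y" using y F r by auto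
      have "r x \<le> L * r y"
        unfolding L_def using y x ry r by (intro intersecting_radius_bound[of _ _ x y]) auto
      moreover obtain w where "dist x w < r x" "dist y w < r y" using y by auto
      ultimately have "dist y x < L * r y + r y"
        using dist_triangle2[of y x w] by linarith
      also have "\<dots> = (L + 1) * r y" by (simp add: algebra_simps)
      also have "\<dots> \<le> 2 ^ k * r y" using k ry by (intro mult_right_mono) (auto simp: L_def)
      finally show "x \<in> (\<Union>y\<in>F. ball y (2 ^ k * r y))" using y by auto
    qed
    fix G assume G: "finite G" "G \<subseteq> F"
    have "(\<Sum>y\<in>G. vol y (2 ^ k * r y) powr \<theta>) \<le> (\<Sum>y\<in>G. (c ^ k) powr \<theta> * vol y (r y) powr \<theta>)"
    proof (rule sum_mono)
      fix y assume "y \<in> G"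
      then have ry: "0 < r y" using G F r by auto
      then have "vol y (2 ^ k * r y) powr \<theta> \<le> (c ^ k * vol y (r y)) powr \<theta>"
        using \<theta> by (intro powr_mono2 vol_doubling_iter) (auto intro!: less_imp_le[OF vol_pos])
      also have "\<dots> = (c ^ k) powr \<theta> * vol y (r y) powr \<theta>"
        by (rule powr_mult)
      finally show "vol y (2 ^ k * r y) powr \<theta> \<le> (c ^ k) powr \<theta> * vol y (r y) powr \<theta>" .
    qed
    also have "\<dots> = (c ^ k) powr \<theta> * (\<Sum>y\<in>G. vol y (r y) powr \<theta>)"
      by (rule sum_distrib_left[symmetric])
    also have "\<dots> \<le> (c ^ k) powr \<theta> * (\<epsilon> / t)"
      by (intro mult_left_mono packing G) simp
    finally have total: "(\<Sum>y\<in>G. vol y (2 ^ k * r y) powr \<theta>) \<le> (c ^ k) powr \<theta> * \<epsilon> / t"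
      by (simp only: times_divide_eq_right)
    have "(\<Sum>y\<in>G. ennreal (vol y (2 ^ k * r y) powr \<theta>)) = ennreal (\<Sum>y\<in>G. vol y (2 ^ k * r y) powr \<theta>)"
      by (rule sum_ennreal) simp
    also have "\<dots> \<le> ennreal ((c ^ k) powr \<theta> * \<epsilon> / t)" using total by (rule ennreal_leI)
    finally show "(\<Sum>y\<in>G. ennreal (enn2real (\<mu> (ball y (2 ^ k * r y))) powr (1 - \<gamma>' * p')))
        \<le> ennreal ((c ^ k) powr (1 - \<gamma>' * p') * \<epsilon> / t)"
      by (simp only: \<theta>_def vol_def)
  qed
qed

lemma exists_small_energy_of_capacity_zero:
  assumes cap: "riesz_capacity \<mu> \<gamma> p E = 0" and p: "1 < p" and \<epsilon>: "0 < \<epsilon>"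
  obtains f where "f \<in> borel_measurable M" "\<And>x. 0 \<le> f x"
    "(\<integral>\<^sup>+y. ennreal (f y powr p) \<partial>M) \<le> ennreal \<epsilon>"
    "\<And>x. x \<in> E \<Longrightarrow> 1 \<le> riesz_potential \<mu> \<gamma> f x"
proof -
  have "(INF f\<in>riesz_admissible \<mu> \<gamma> p E. ennreal (Lp_norm M p f powr p)) < ennreal \<epsilon>"
    using cap \<epsilon> by (simp add: riesz_capacity_def)
  then obtain f where f: "f \<in> riesz_admissible \<mu> \<gamma> p E" "ennreal (Lp_norm M p f powr p) < ennreal \<epsilon>"
    by (auto simp: INF_less_iff)
  then have meas: "f \<in> borel_measurable M" and nonneg: "\<And>x. 0 \<le> f x"
    and int: "integrable M (\<lambda>x. f x powr p)" and pot: "\<And>x. x \<in> E \<Longrightarrow> 1 \<le> riesz_potential \<mu> \<gamma> f x"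
    by (auto simp: riesz_admissible_def Lp_plus_def Lp_space_def)
  have "(\<integral>\<^sup>+y. ennreal (f y powr p) \<partial>M) = ennreal (\<integral>y. f y powr p \<partial>M)"
    using int by (intro nn_integral_eq_integral) auto
  also have "(\<integral>y. f y powr p \<partial>M) = Lp_norm M p f powr p"
    using p nonneg by (simp add: Lp_norm_def powr_powr integral_nonneg)
  finally show thesis using that[OF meas nonneg _ pot] f(2) by simp
qed

lemma hausdorff_content_eq_0:
  assumes \<gamma>: "0 < \<gamma>" "\<gamma> < 1" and p: "1 < p" and b: "\<gamma>' * p' < \<gamma> * p" "\<gamma> * p < 1"
    and cap: "riesz_capacity \<mu> \<gamma> p E = 0"
  shows "hausdorff_content \<mu> \<gamma>' p' \<infinity> E = 0"
proof -
  obtain t \<epsilon>0 where t: "0 < t" "0 < \<epsilon>0" and conc: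
    "\<And>f x. f \<in> borel_measurable M \<Longrightarrow> (\<And>y. 0 \<le> f y) \<Longrightarrow>
      (\<integral>\<^sup>+y. ennreal (f y powr p) \<partial>M) \<le> ennreal \<epsilon>0 \<Longrightarrow> 1 \<le> riesz_potential \<mu> \<gamma> f x \<Longrightarrow>
      \<exists>r>0. ennreal (t * vol x r powr (1 - \<gamma>' * p')) < (\<integral>\<^sup>+y\<in>ball x r. ennreal (f y powr p) \<partial>M)"
    using exists_concentration_constant[OF \<gamma> p b] by blast
  obtain k where k: "max 1 ((2 * C * c) powr (1/s)) + 1 < 2 ^ k"
    using real_arch_pow[of 2 "max 1 ((2 * C * c) powr (1/s)) + 1"] by auto
  define D where "D = (c ^ k) powr (1 - \<gamma>' * p') / t"
  have D: "0 < D" using c t by (simp add: D_def)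
  have small: "hausdorff_content \<mu> \<gamma>' p' \<infinity> E \<le> ennreal (D * \<epsilon>)" if \<epsilon>: "0 < \<epsilon>" "\<epsilon> \<le> \<epsilon>0" for \<epsilon>
  proof -
    obtain f where f: "f \<in> borel_measurable M" "\<And>x. 0 \<le> f x"
      "(\<integral>\<^sup>+y. ennreal (f y powr p) \<partial>M) \<le> ennreal \<epsilon>"
      "\<And>x. x \<in> E \<Longrightarrow> 1 \<le> riesz_potential \<mu> \<gamma> f x"
      using exists_small_energy_of_capacity_zero[OF cap p \<epsilon>(1)] by blast
    define \<nu> where "\<nu> = density M (\<lambda>y. ennreal (f y powr p))"
    have nu: "emeasure \<nu> A = (\<integral>\<^sup>+y\<in>A. ennreal (f y powr p) \<partial>M)" if "A \<in> sets M" for A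
      unfolding \<nu>_def using f(1) that by (intro emeasure_density) auto
    have le0: "(\<integral>\<^sup>+y. ennreal (f y powr p) \<partial>M) \<le> ennreal \<epsilon>0"
      using f(3) \<epsilon> by (meson ennreal_leI order_trans)
    have "hausdorff_content \<mu> \<gamma>' p' \<infinity> E \<le> ennreal ((c ^ k) powr (1 - \<gamma>' * p') * \<epsilon> / t)"
    proof (rule hausdorff_content_le_of_concentration)
      show "sets \<nu> = sets M" by (simp add: \<nu>_def)
      have "emeasure \<nu> UNIV = (\<integral>\<^sup>+y. ennreal (f y powr p) \<partial>M)"
        using nu[of UNIV] sets.top[of M] by simp
      then show "emeasure \<nu> UNIV \<le> ennreal \<epsilon>" using f(3) by simp
      show "\<exists>r>0. ennreal (t * vol x r powr (1 - \<gamma>' * p')) < emeasure \<nu> (ball x r)" if "x \<in> E" for x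
        using conc[OF f(1,2) le0 f(4)[OF that]] by (simp add: nu ball_in_M)
    qed (use t \<epsilon> b k in auto)
    then show ?thesis by (simp add: D_def)
  qed
  have "hausdorff_content \<mu> \<gamma>' p' \<infinity> E \<le> 0"
  proof (rule ennreal_le_epsilon)
    fix e :: real assume e: "0 < e"
    have "hausdorff_content \<mu> \<gamma>' p' \<infinity> E \<le> ennreal (D * min \<epsilon>0 (e / D))"
      using t e D by (intro small) auto
    also have "\<dots> \<le> ennreal e"
      using D mult_left_mono[OF min.cobounded2[of \<epsilon>0 "e / D"], of D] by (intro ennreal_leI) simp
    finally show "hausdorff_content \<mu> \<gamma>' p' \<infinity> E \<le> 0 + ennreal e" by simp
  qed
  then show ?thesis by simp
qed

end

theorem theorem4p3:
  fixes \<mu> :: "'a::metric_space set \<Rightarrow> ennreal"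
    and p p' \<gamma> \<gamma>' :: real
    and E :: "'a set"
  assumes "doubling_space \<mu>"
    and "\<exists>C>0. \<exists>s>0. \<forall>y R. 0 < R \<longrightarrow> (\<forall>z\<in>ball y R. \<forall>r. 0 < r \<and> r \<le> R \<longrightarrow>
           \<mu> (ball z r) / \<mu> (ball y R) \<le> ennreal (C * (r / R) powr s))"
    and "1 < p" and "1 < p'"
    and "0 < \<gamma>" and "\<gamma> < 1"
    and "0 < \<gamma>'" and "\<gamma>' < 1"
    and "\<gamma> * p < 1" and "\<gamma>' * p' < 1"
    and "\<gamma>' * p' < \<gamma> * p"
    and "riesz_capacity \<mu> \<gamma> p E = 0"
  shows "hausdorff_content \<mu> \<gamma>' p' \<infinity> E = 0"
proof -
  obtain c where c: "1 \<le> c" "\<And>x r. 0 < r \<Longrightarrow> \<mu> (ball x (2 * r)) \<le> ennreal c * \<mu> (ball x r)"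
    using doubling_space.doubling[OF assms(1)] by blast
  obtain C s where "0 < C" "0 < s" "\<And>y R z r. 0 < R \<Longrightarrow> z \<in> ball y R \<Longrightarrow> 0 < r \<Longrightarrow> r \<le> R \<Longrightarrow>
           \<mu> (ball z r) / \<mu> (ball y R) \<le> ennreal (C * (r / R) powr s)"
    using assms(2) by blast
  then interpret reverse_doubling_space \<mu> c C s
    using assms(1) c by (simp add: reverse_doubling_space_def reverse_doubling_space_axioms_def)
  show ?thesis by (rule hausdorff_content_eq_0[OF assms(5,6,3,11,9,12)])
qed

end
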